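(* Let $\sigma_*:=\dfrac{\arctan 2}{\arctan 3}\in(0,1)$. There exist matrices $A_0,A_1,A_2\in\mathcal{S}^2$ satisfying \[\mathrm{Id}_2\le A_j\le 3\,\mathrm{Id}_2,\qquad j=0,1,2,\] and a nonzero function $u\in C^{2,\sigma_*}_{\mathrm{loc}}(\mathbb{R}^2)$, homogeneous of degree $2+\sigma_*$, such that \[\max_{j=0,1,2}\mathrm{tr}(A_jD^2u(x))=0\qquad\text{for all }x\in\mathbb{R}^2.\] In particular, $u\notin C^{2,\beta}$ at the origin for every $\beta>\sigma_*$.
   Context: $\mathcal{S}^2$ denotes the space of real symmetric $2\times 2$ matrices, and matrix inequalities are in the sense of quadratic forms. A function $u:\mathbb{R}^2\to\mathbb{R}$ is homogeneous of degree $d$ if $u(tx)=t^du(x)$ for all $t>0$ and $x\in\mathbb{R}^2$. $C^{2,\sigma}_{\mathrm{loc}}$ denotes the $C^2$ functions whose Hessian $D^2u$ is locally $\sigma$-Hölder continuous. "$u\notin C^{2,\beta}$ at the origin" means that there are no constants $C,r>0$ such that $|D^2u(x)-D^2u(0)|\le C|x|^\beta$ for all $|x|<r$. *)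

theory Defs
  imports "HOL-Analysis.Analysis"
begin

definition sym_matrices :: "(real^'n^'n) set" where
  "sym_matrices = {A. transpose A = A}"

definition quad_form_le :: "real^'n^'n \<Rightarrow> real^'n^'n \<Rightarrow> bool" where
  "quad_form_le A B \<longleftrightarrow> (\<forall>v. v \<bullet> (A *v v) \<le> v \<bullet> (B *v v))"

definition homogeneous_of_degree :: "real \<Rightarrow> (real^'n \<Rightarrow> real) \<Rightarrow> bool" where
  "homogeneous_of_degree d u \<longleftrightarrow> (\<forall>t>0. \<forall>x. u (t *\<^sub>R x) = t powr d * u x)"

definition gradient :: "(real^'n \<Rightarrow> real) \<Rightarrow> real^'n \<Rightarrow> real^'n" where
  "gradient u x = (\<chi> i. frechet_derivative u (at x) (axis i 1))"

(* Meaningful only where u is twice differentiable: frechet_derivative is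
   a total function with an unspecified value elsewhere. *)
definition hessian :: "(real^'n \<Rightarrow> real) \<Rightarrow> real^'n \<Rightarrow> real^'n^'n" where
  "hessian u x = jacobian (gradient u) (at x)"

definition C2 :: "(real^'n \<Rightarrow> real) \<Rightarrow> bool" where
  "C2 u \<longleftrightarrow> u differentiable_on UNIV \<and> gradient u differentiable_on UNIV
     \<and> continuous_on UNIV (hessian u)"

definition locally_holder ::
    "real \<Rightarrow> ('a::metric_space \<Rightarrow> 'b::metric_space) \<Rightarrow> bool" where
  "locally_holder \<sigma> f \<longleftrightarrow>
     (\<forall>K. compact K \<longrightarrow> (\<exists>C. \<forall>x\<in>K. \<forall>y\<in>K. dist (f x) (f y) \<le> C * dist x y powr \<sigma>))"

(* Matrices carry the Euclidean (Frobenius) norm of real^'n^'n. *)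
definition C2_holder_loc :: "real \<Rightarrow> (real^'n \<Rightarrow> real) set" where
  "C2_holder_loc \<sigma> = {u. C2 u \<and> locally_holder \<sigma> (hessian u)}"

definition C2_holder_at_origin :: "real \<Rightarrow> (real^'n \<Rightarrow> real) \<Rightarrow> bool" where
  "C2_holder_at_origin \<beta> u \<longleftrightarrow>
     (\<exists>C>0. \<exists>r>0. \<forall>x. norm x < r \<longrightarrow>
        norm (hessian u x - hessian u 0) \<le> C * norm x powr \<beta>)"

definition sigma_star :: real where
  "sigma_star = arctan 2 / arctan 3"

end

theory Submission
  imports Defs
begin

text \<open>
  Cut the plane into three sectors of opening angle \<open>2\<pi>/3\<close>, centred at the directions
  \<open>d\<^sub>j\<close> of the cube roots of unity, and take \<open>A\<^sub>j = Id + 2 d\<^sub>j d\<^sub>j\<^sup>T\<close>.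
  In coordinates along and across \<open>d\<^sub>j\<close>, the linear map \<open>L\<^sub>j(a, b) = a + i \<surd>3 b\<close> turns
  \<open>tr (A\<^sub>j D\<^sup>2)\<close> into a multiple of the Laplacian, so \<open>u = Re (L\<^sub>j\<^bsup>2+\<sigma>\<^esup>)\<close> solves the \<open>j\<close>-th
  equation on the \<open>j\<close>-th sector, which \<open>L\<^sub>j\<close> maps onto the wedge \<open>\<bar>arg z\<bar> \<le> arctan 3\<close>.
  There \<open>z\<^sup>\<sigma>\<close> has argument at most \<open>\<sigma> arctan 3 = arctan 2\<close>, and the other two inequalities
  amount exactly to \<open>\<bar>Im z\<^sup>\<sigma>\<bar> \<le> 2 Re z\<^sup>\<sigma>\<close>. On a ray common to two sectors the images are
  conjugate to each other, \<open>z\<close> is a multiple of \<open>1 + 3i\<close> and \<open>z\<^sup>\<sigma>\<close> of \<open>1 + 2i\<close>; since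
  \<open>(1 + 2i)(1 + 3i) = 5(-1 + i)\<close>, the normal derivative vanishes and \<open>u\<close> is twice differentiable
  across the ray.
\<close>

section \<open>Gluing derivatives and Holder bounds along closed covers\<close>

lemma has_derivative_within_Un:
  assumes "(f has_derivative f') (at x within S)" "(f has_derivative f') (at x within T)"
  shows "(f has_derivative f') (at x within S \<union> T)"
  using assms unfolding has_derivative_within by (simp add: Lim_within_Un)

text \<open>Away from a closed piece the filter \<open>at x within S i\<close> is trivial, so only
  the pieces containing \<open>x\<close> constrain the derivative. All of these must supply the same
  \<open>f'\<close>.\<close>

lemma has_derivative_glue:
  assumes "finite I" "x \<in> interior (\<Union>i\<in>I. S i)"
    and closed: "\<And>i. i \<in> I \<Longrightarrow> closed (S i)"
    and deriv: "\<And>i. i \<in> I \<Longrightarrow> x \<in> S i \<Longrightarrow> (g i has_derivative f') (at x within S i)"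
    and eq: "\<And>i y. i \<in> I \<Longrightarrow> y \<in> S i \<Longrightarrow> f y = g i y"
  shows "(f has_derivative f') (at x)"
proof -
  have "bounded_linear f'"
  proof -
    obtain i where "i \<in> I" "x \<in> S i"
      using assms(2) interior_subset by blast
    then show ?thesis
      using deriv has_derivative_bounded_linear by blast
  qed
  have "(f has_derivative f') (at x within S i)" if "i \<in> I" for i
  proof (cases "x \<in> S i")
    case True
    then show ?thesis
      using has_derivative_transform[OF True _ deriv[OF that True]] eq[OF that] by simp
  next
    case False
    then have "at x within S i = bot"
      using closed[OF that] by (metis closed_limpt trivial_limit_within)
    then show ?thesis
      using \<open>bounded_linear f'\<close> unfolding has_derivative_within by simp
  qed
  with \<open>finite I\<close> have "(f has_derivative f') (at x within (\<Union>i\<in>I. S i))"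
  proof (induction I rule: finite_induct)
    case empty
    then show ?case
      using \<open>bounded_linear f'\<close> unfolding has_derivative_within by simp
  next
    case (insert i I)
    then show ?case
      by (simp add: has_derivative_within_Un)
  qed
  then show ?thesis
    by (simp only: at_within_interior[OF assms(2)])
qed

definition holder_on :: "real \<Rightarrow> real \<Rightarrow> 'a::metric_space set \<Rightarrow> ('a \<Rightarrow> 'b::metric_space) \<Rightarrow> bool" where
  "holder_on \<sigma> C S f \<longleftrightarrow> (\<forall>x\<in>S. \<forall>y\<in>S. dist (f x) (f y) \<le> C * dist x y powr \<sigma>)"

lemma holder_onD:
  "holder_on \<sigma> C S f \<Longrightarrow> x \<in> S \<Longrightarrow> y \<in> S \<Longrightarrow> dist (f x) (f y) \<le> C * dist x y powr \<sigma>"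
  by (simp add: holder_on_def)

lemma holder_on_mono:
  assumes "holder_on \<sigma> C S f" "C \<le> D"
  shows "holder_on \<sigma> D S f"
  unfolding holder_on_def
proof (intro ballI)
  fix x y assume "x \<in> S" "y \<in> S"
  then have "dist (f x) (f y) \<le> C * dist x y powr \<sigma>"
    using assms(1) by (rule holder_onD[rotated 1])
  also have "\<dots> \<le> D * dist x y powr \<sigma>"
    by (rule mult_right_mono[OF assms(2)]) simp
  finally show "dist (f x) (f y) \<le> D * dist x y powr \<sigma>" .
qed

text \<open>If the segment from \<open>x\<close> to \<open>y\<close> misses \<open>S \<inter> T\<close>, then by connectedness it passes through both
  \<open>S \<inter> U\<close> and \<open>T \<inter> U\<close>.\<close>

lemma holder_glue_aux:
  fixes x y :: "'a::real_normed_vector"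
  assumes cl: "closed S" "closed T" "closed U" and un: "S \<union> T \<union> U = UNIV"
    and h: "holder_on \<sigma> C S f" "holder_on \<sigma> C T f" "holder_on \<sigma> C U f"
    and "0 \<le> C" "0 \<le> \<sigma>" "x \<in> S" "y \<in> T"
  shows "dist (f x) (f y) \<le> 3 * C * dist x y powr \<sigma>"
proof -
  let ?I = "closed_segment x y"
  let ?D = "C * dist x y powr \<sigma>"
  \<comment> \<open>Points of the segment are no farther apart than its endpoints, so each hop
    inside one piece costs at most \<open>?D\<close>. At most three hops are needed, hence the
    factor 3.\<close>
  have seg: "dist (f a) (f b) \<le> ?D" 
    if "holder_on \<sigma> C V f" "a \<in> V" "b \<in> V" "a \<in> ?I" "b \<in> ?I" for a b V
  proof -
    have ab: "a \<in> ?I" "b \<in> ?I" by fact+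
    have "dist a b \<le> dist x y"
    proof -
      obtain s t where st: "0 \<le> s" "s \<le> 1" "a = (1 - s) *\<^sub>R x + s *\<^sub>R y"
        "0 \<le> t" "t \<le> 1" "b = (1 - t) *\<^sub>R x + t *\<^sub>R y"
        using ab by (auto simp: in_segment)
      have "a - b = (t - s) *\<^sub>R (x - y)"
        unfolding st(3,6) by (simp add: algebra_simps)
      then have "dist a b = \<bar>t - s\<bar> * dist x y"
        by (simp add: dist_norm)
      also have "\<dots> \<le> 1 * dist x y"
        using st by (intro mult_right_mono) auto
      finally show ?thesis by simp
    qed
    then have "C * dist a b powr \<sigma> \<le> ?D"
      using assms by (intro mult_left_mono powr_mono2) auto
    with holder_onD[OF that(1-3)] show ?thesis by linarith
  qed
  have xy: "x \<in> ?I" "y \<in> ?I" by auto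
  have D0: "0 \<le> ?D" using assms by simp
  have conn: "connected ?I" by simp
  show ?thesis
  proof (cases "S \<inter> T \<inter> ?I = {}")
    case False
    then obtain z where z: "z \<in> S" "z \<in> T" "z \<in> ?I" by blast
    have "dist (f x) (f z) \<le> ?D" "dist (f z) (f y) \<le> ?D"
      using seg[OF h(1) \<open>x \<in> S\<close> z(1) xy(1) z(3)] seg[OF h(2) z(2) \<open>y \<in> T\<close> z(3) xy(2)] by auto
    then show ?thesis
      using dist_triangle[of "f x" "f y" "f z"] D0 by linarith
  next
    case True
    have "S \<inter> (T \<union> U) \<inter> ?I \<noteq> {}"
      using connected_closedD[OF conn, of S "T \<union> U"] cl un xy assms by blast
    then obtain z where z: "z \<in> S" "z \<in> U" "z \<in> ?I" using True by blast
    have "T \<inter> (S \<union> U) \<inter> ?I \<noteq> {}"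
      using connected_closedD[OF conn, of T "S \<union> U"] cl un xy assms by blast
    then obtain w where w: "w \<in> T" "w \<in> U" "w \<in> ?I" using True by blast
    have "dist (f x) (f z) \<le> ?D" "dist (f z) (f w) \<le> ?D" "dist (f w) (f y) \<le> ?D"
      using seg[OF h(1) \<open>x \<in> S\<close> z(1) xy(1) z(3)] seg[OF h(3) z(2) w(2) z(3) w(3)]
        seg[OF h(2) w(1) \<open>y \<in> T\<close> w(3) xy(2)] by auto
    then show ?thesis
      using dist_triangle[of "f x" "f y" "f z"] dist_triangle[of "f z" "f y" "f w"] by linarith
  qed
qed

lemma holder_glue:
  fixes f :: "'a::real_normed_vector \<Rightarrow> 'b::metric_space"
  assumes cl: "closed S" "closed T" "closed U" and un: "S \<union> T \<union> U = UNIV"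
    and h: "holder_on \<sigma> C S f" "holder_on \<sigma> C T f" "holder_on \<sigma> C U f"
    and "0 \<le> C" "0 \<le> \<sigma>"
  shows "holder_on \<sigma> (3 * C) UNIV f"
  unfolding holder_on_def
proof (intro ballI)
  fix x y :: 'a
  have diag: "dist (f x) (f y) \<le> 3 * C * dist x y powr \<sigma>" 
    if "holder_on \<sigma> C V f" "x \<in> V" "y \<in> V" for V
    using holder_onD[OF holder_on_mono[OF that(1)] that(2,3), of "3 * C"] \<open>0 \<le> C\<close> by simp
  note aux = holder_glue_aux[where \<sigma>=\<sigma> and C=C and f=f, OF _ _ _ _ _ _ _ assms(8,9)]
  have "x \<in> S \<or> x \<in> T \<or> x \<in> U" "y \<in> S \<or> y \<in> T \<or> y \<in> U" using un by auto
  then show "dist (f x) (f y) \<le> 3 * C * dist x y powr \<sigma>"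
    using diag[OF h(1)] diag[OF h(2)] diag[OF h(3)]
      aux[OF cl(1,2,3) _ h(1,2,3), of x y] aux[OF cl(1,3,2) _ h(1,3,2), of x y]
      aux[OF cl(2,1,3) _ h(2,1,3), of x y] aux[OF cl(2,3,1) _ h(2,3,1), of x y]
      aux[OF cl(3,1,2) _ h(3,1,2), of x y] aux[OF cl(3,2,1) _ h(3,2,1), of x y] un
    by (auto simp: Un_ac)
qed

lemma holder_on_imp_continuous_on:
  assumes "holder_on \<sigma> C S f" "0 < \<sigma>"
  shows "continuous_on S f"
  unfolding continuous_on_def
proof
  fix x assume "x \<in> S"
  have "((\<lambda>y. C * dist y x powr \<sigma>) \<longlongrightarrow> C * 0 powr \<sigma>) (at x within S)"
    using assms(2) by (intro tendsto_intros tendsto_powr2) (auto intro!: tendsto_eq_intros)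
  then have lim: "((\<lambda>y. C * dist y x powr \<sigma>) \<longlongrightarrow> 0) (at x within S)"
    by simp
  have "((\<lambda>y. dist (f y) (f x)) \<longlongrightarrow> 0) (at x within S)"
  proof (rule tendsto_sandwich[OF _ _ tendsto_const lim])
    show "\<forall>\<^sub>F y in at x within S. dist (f y) (f x) \<le> C * dist y x powr \<sigma>"
      using assms(1) \<open>x \<in> S\<close> by (simp add: eventually_at_filter holder_on_def)
  qed simp
  then show "(f \<longlongrightarrow> f x) (at x within S)"
    by (simp add: tendsto_dist_iff[of f])
qed

section \<open>Complex powers on the wedge\<close>

lemma sigma_star_bounds: "0 < sigma_star" "sigma_star < 1"
  by (simp_all add: sigma_star_def arctan_less_iff)

lemma powr_of_real_scale:
  assumes "0 < t"
  shows "(of_real t * z) powr of_real a = of_real (t powr a) * z powr (of_real a :: complex)"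
  using assms by (subst powr_times_real_left) (auto simp: powr_of_real)

lemma powr_Suc_complex: "z powr (1 + a) = z * z powr (a :: complex)"
  by (auto simp: powr_def exp_add algebra_simps)

definition wedge :: "complex set" where
  "wedge = {z. \<bar>Im z\<bar> \<le> 3 * Re z}"

lemma convex_wedge: "convex wedge"
proof (rule convexI)
  fix x y :: complex and u v :: real
  assume xy: "x \<in> wedge" "y \<in> wedge" and uv: "0 \<le> u" "0 \<le> v"
  have "\<bar>u * Im x + v * Im y\<bar> \<le> u * \<bar>Im x\<bar> + v * \<bar>Im y\<bar>"
    using uv abs_triangle_ineq[of "u * Im x" "v * Im y"] by (simp add: abs_mult)
  also have "\<dots> \<le> u * (3 * Re x) + v * (3 * Re y)"
    using xy uv by (intro add_mono mult_left_mono) (auto simp: wedge_def)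
  finally show "u *\<^sub>R x + v *\<^sub>R y \<in> wedge"
    by (simp add: wedge_def algebra_simps)
qed

text \<open>The wedge meets the branch cut of \<open>powr\<close> only at its apex, so the apex is
  the only point that needs separate treatment.\<close>

lemma wedge_cases:
  assumes "z \<in> wedge"
  obtains "z = 0" | "0 < Re z" "z \<noteq> 0" "z \<notin> \<real>\<^sub>\<le>\<^sub>0"
  using assms
  by (cases "Re z = 0") (auto simp: wedge_def complex_eq_iff complex_nonpos_Reals_iff)

lemma powr_polar:
  assumes "z \<noteq> 0"
  shows "z powr of_real a = of_real (norm z powr a) * cis (a * Arg z)"
  using assms
  by (simp add: powr_def exp_eq_polar Arg_eq_Im_Ln)

text \<open>The power multiplies arguments by \<open>sigma_star\<close>, whose value is exactly the
  one that sends the half-angle \<open>arctan 3\<close> to \<open>arctan 2\<close>. At the apex both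
  sides are 0.\<close>

lemma wedge_powr_sigma_star:
  assumes "z \<in> wedge"
  shows "\<bar>Im (z powr of_real sigma_star)\<bar> \<le> 2 * Re (z powr of_real sigma_star)"
  using assms
proof (cases rule: wedge_cases)
  case 2
  define t where "t = sigma_star * Arg z"
  have "Arg z = arctan (Im z / Re z)"
    using 2 arg_conv_arctan by blast
  moreover have "\<bar>Im z / Re z\<bar> \<le> 3"
    using assms 2 by (simp add: wedge_def field_simps)
  ultimately have "\<bar>Arg z\<bar> \<le> arctan 3"
    by (simp add: abs_arctan arctan_le_iff)
  then have "\<bar>t\<bar> \<le> sigma_star * arctan 3"
    using sigma_star_bounds by (simp add: t_def abs_mult)
  also have "\<dots> = arctan 2"
    by (simp add: sigma_star_def)
  finally have t: "\<bar>t\<bar> \<le> arctan 2" .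
  then have c: "0 < cos t"
    using arctan_ubound[of 2] by (intro cos_gt_zero_pi) auto
  have "arctan (tan t) = t"
    using t arctan_ubound[of 2] by (intro arctan_tan) auto
  then have "\<bar>tan t\<bar> \<le> 2"
    using t by (metis abs_arctan arctan_le_iff)
  then have "\<bar>sin t\<bar> \<le> 2 * cos t"
    using c by (simp add: tan_def field_simps)
  then have "norm z powr sigma_star * \<bar>sin t\<bar> \<le> norm z powr sigma_star * (2 * cos t)"
    by (intro mult_left_mono) auto
  then show ?thesis
    using 2 by (simp add: powr_polar t_def abs_mult mult_ac)
qed auto

text \<open>The equality case on the upper edge, from which the gradients and Hessians of
  neighbouring pieces will match.\<close>

lemma wedge_edge_powr_sigma_star:
  assumes "Im z = 3 * Re z" "z \<in> wedge"
  shows "Im (z powr of_real sigma_star) = 2 * Re (z powr of_real sigma_star)"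
  using assms(2)
proof (cases rule: wedge_cases)
  case 2
  define t where "t = sigma_star * Arg z"
  have "Arg z = arctan (Im z / Re z)"
    using 2 arg_conv_arctan by blast
  then have "t = arctan 2"
    using 2 assms by (simp add: t_def sigma_star_def)
  then have "sin t = 2 * cos t"
    using tan_arctan[of 2] by (simp add: tan_def field_simps)
  then show ?thesis
    using 2 by (simp add: powr_polar t_def mult_ac)
qed auto

text \<open>Off the apex this is the usual rule. At 0 the difference quotient has norm
  \<open>norm y powr (a - 1)\<close>, which tends to 0 because \<open>a > 1\<close>.\<close>

lemma has_field_derivative_powr_wedge:
  assumes "z \<in> wedge" "1 < a"
  shows "((\<lambda>z. z powr of_real a) has_field_derivative of_real a * z powr of_real (a - 1)) (at z within wedge)"
  using assms(1)
proof (cases rule: wedge_cases)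
  case 1
  have "((\<lambda>y. (y powr of_real a - 0) / (y - 0)) \<longlongrightarrow> 0) (at (0::complex) within wedge)"
  proof (rule tendsto_norm_zero_cancel)
    have "((\<lambda>y. norm y powr (a - 1)) \<longlongrightarrow> 0 powr (a - 1)) (at (0::complex) within wedge)"
      using assms(2) by (intro tendsto_powr2) (auto intro!: tendsto_eq_intros)
    then have lim: "((\<lambda>y. norm y powr (a - 1)) \<longlongrightarrow> 0) (at (0::complex) within wedge)"
      by simp
    show "((\<lambda>y. norm ((y powr of_real a - 0) / (y - 0))) \<longlongrightarrow> 0) (at (0::complex) within wedge)"
    proof (rule Lim_transform_eventually[OF lim])
      have "norm y powr (a - 1) = norm ((y powr of_real a - 0) / (y - 0))" if "y \<noteq> 0" for y :: complex
        using that by (simp add: norm_divide norm_powr_real_powr' powr_diff)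
      then show "\<forall>\<^sub>F y in at (0::complex) within wedge.
          norm y powr (a - 1) = norm ((y powr of_real a - 0) / (y - 0))"
        by (simp only: eventually_at_filter) simp
    qed
  qed
  with 1 show ?thesis
    by (simp add: has_field_derivative_iff)
next
  case 2
  then show ?thesis
    using has_field_derivative_powr[of z "of_real a"]
    by (simp add: has_field_derivative_at_within)
qed

text \<open>If \<open>z - w\<close> is large compared with \<open>z\<close>, the triangle inequality
  suffices, with constant 2 * 2^\<sigma> < 4. Otherwise the segment stays away from 0 and the mean
  value inequality applies.\<close>

lemma powr_diff_bound:
  fixes z w :: complex
  assumes "0 < \<sigma>" "\<sigma> < 1" "z \<in> wedge" "w \<in> wedge" "norm w \<le> norm z"
  shows "norm (z powr of_real \<sigma> - w powr of_real \<sigma>) \<le> 4 * norm (z - w) powr \<sigma>"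
proof (cases "norm z \<le> 2 * norm (z - w)")
  case True
  have "norm (z powr of_real \<sigma> - w powr of_real \<sigma>) \<le> norm z powr \<sigma> + norm w powr \<sigma>"
    using norm_triangle_ineq4[of "z powr of_real \<sigma>" "w powr of_real \<sigma>"] by (simp add: norm_powr_real_powr')
  also have "\<dots> \<le> 2 * norm z powr \<sigma>"
    using assms powr_mono2[of \<sigma> "norm w" "norm z"] by simp
  also have "\<dots> \<le> 2 * (2 * norm (z - w)) powr \<sigma>"
    using assms True by (intro mult_left_mono powr_mono2) auto
  also have "\<dots> = 2 * 2 powr \<sigma> * norm (z - w) powr \<sigma>"
    by (simp add: powr_mult)
  also have "\<dots> \<le> 4 * norm (z - w) powr \<sigma>"
    using assms powr_mono[of \<sigma> 1 2] by (intro mult_right_mono) auto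
  finally show ?thesis .
next
  case False
  then have pos: "0 < norm (z - w)" if "z \<noteq> w" using that by auto
  have near: "norm z / 2 \<le> norm y \<and> y \<noteq> 0 \<and> y \<notin> \<real>\<^sub>\<le>\<^sub>0" if "y \<in> closed_segment z w" for y
  proof -
    have "norm (y - z) \<le> norm (z - w)"
      using that by (metis norm_minus_commute segment_bound(1))
    then have "norm z / 2 \<le> norm y"
      using False norm_triangle_ineq2[of z "z - y"] unfolding norm_minus_commute[of y z] by simp
    moreover from this have "y \<noteq> 0"
      using False by auto
    moreover have "y \<in> wedge"
      using that closed_segment_subset[OF assms(3,4) convex_wedge] by blast
    ultimately show ?thesis
      using wedge_cases by metis
  qed
  \<comment> \<open>On the segment \<open>norm y\<close> is at least \<open>norm z / 2\<close>,
    which exceeds \<open>norm (z - w)\<close>. As the exponent \<sigma> - 1 is negative,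
    \<open>B\<close> bounds the derivative.\<close>
  define B where "B = norm (z - w) powr (\<sigma> - 1)"
  have "norm (z powr of_real \<sigma> - w powr of_real \<sigma>) \<le> B * norm (z - w)" if "z \<noteq> w"
  proof (rule field_differentiable_bound[of "closed_segment z w"])
    fix y assume y: "y \<in> closed_segment z w"
    show "((\<lambda>z. z powr of_real \<sigma>) has_field_derivative of_real \<sigma> * y powr of_real (\<sigma> - 1)) (at y within closed_segment z w)"
      using has_field_derivative_powr[of y "of_real \<sigma>"] near[OF y] has_field_derivative_at_within by simp
    have "norm (of_real \<sigma> * y powr of_real (\<sigma> - 1)) = \<sigma> * norm y powr (\<sigma> - 1)"
      using assms by (simp add: norm_mult norm_powr_real_powr' del: of_real_diff)
    also have "\<dots> \<le> 1 * B"
      unfolding B_def using assms near[OF y] False pos[OF that]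
      by (intro mult_mono powr_mono2') auto
    finally show "norm (of_real \<sigma> * y powr of_real (\<sigma> - 1)) \<le> B" by simp
  qed auto
  moreover have "B * norm (z - w) = norm (z - w) powr \<sigma>" if "z \<noteq> w"
    using that by (simp add: B_def powr_diff)
  ultimately have "norm (z powr of_real \<sigma> - w powr of_real \<sigma>) \<le> norm (z - w) powr \<sigma>"
    by (cases "z = w") simp_all
  also have "\<dots> \<le> 4 * norm (z - w) powr \<sigma>"
    by simp
  finally show ?thesis .
qed

lemma holder_powr_wedge:
  assumes "0 < \<sigma>" "\<sigma> < 1"
  shows "holder_on \<sigma> 4 wedge (\<lambda>z. z powr complex_of_real \<sigma>)"
  unfolding holder_on_def
proof (intro ballI)
  fix z w assume "z \<in> wedge" "w \<in> wedge"
  then show "dist (z powr complex_of_real \<sigma>) (w powr of_real \<sigma>) \<le> 4 * dist z w powr \<sigma>"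
    using powr_diff_bound[OF assms, of z w] powr_diff_bound[OF assms, of w z]
    by (metis dist_commute dist_norm linear)
qed

lemma holder_on_bounded_linear_compose:
  assumes "holder_on \<sigma> C T f" "0 \<le> C" "0 \<le> \<sigma>" "bounded_linear g" "bounded_linear h" "h ` S \<subseteq> T"
  shows "\<exists>D\<ge>0. holder_on \<sigma> D S (\<lambda>x. g (f (h x)))"
proof -
  obtain K where K: "0 \<le> K" "\<And>x. norm (g x) \<le> norm x * K"
    using bounded_linear.nonneg_bounded[OF assms(4)] by blast
  obtain M where M: "0 \<le> M" "\<And>x. norm (h x) \<le> norm x * M"
    using bounded_linear.nonneg_bounded[OF assms(5)] by blast
  have "holder_on \<sigma> (C * M powr \<sigma> * K) S (\<lambda>x. g (f (h x)))"
    unfolding holder_on_def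
  proof (intro ballI)
    fix x y assume xy: "x \<in> S" "y \<in> S"
    have "dist (g (f (h x))) (g (f (h y))) = norm (g (f (h x) - f (h y)))"
      by (simp add: dist_norm linear_diff[OF bounded_linear.linear, OF assms(4)])
    also have "\<dots> \<le> dist (f (h x)) (f (h y)) * K"
      using K by (simp add: dist_norm)
    also have "\<dots> \<le> (C * dist (h x) (h y) powr \<sigma>) * K"
      using xy assms K by (intro mult_right_mono holder_onD) auto
    also have "\<dots> \<le> (C * (dist x y * M) powr \<sigma>) * K"
      using M(2)[of "x - y"] assms K
      by (intro mult_right_mono mult_left_mono powr_mono2)
        (auto simp: dist_norm linear_diff[OF bounded_linear.linear, OF assms(5)])
    finally show "dist (g (f (h x))) (g (f (h y))) \<le> C * M powr \<sigma> * K * dist x y powr \<sigma>"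
      by (simp add: powr_mult M mult_ac)
  qed
  then show ?thesis
    using K M assms by (intro exI[of _ "C * M powr \<sigma> * K"]) auto
qed

section \<open>Linear maps, coefficient matrices and sectors\<close>

text \<open>The components of \<open>\<langle>p, d\<^sub>j\<rangle> + i \<surd>3 \<langle>p, d\<^sub>j\<^sup>\<bottom>\<rangle>\<close> with respect to the coordinates of \<open>p\<close>.\<close>

definition form :: "nat \<Rightarrow> 2 \<Rightarrow> complex" where
  "form j i =
    (if j = 0 then if i = 1 then 1 else Complex 0 (sqrt 3)
     else if j = 1 then if i = 1 then Complex (- 1/2) (- 3/2) else Complex (sqrt 3 / 2) (- sqrt 3 / 2)
     else if i = 1 then Complex (- 1/2) (3/2) else Complex (- sqrt 3 / 2) (- sqrt 3 / 2))"

definition lin :: "nat \<Rightarrow> real^2 \<Rightarrow> complex" where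
  "lin j p = (\<Sum>i\<in>UNIV. of_real (p$i) * form j i)"

text \<open>The matrix Id + 2 d d^T written out, with d the unit vector at angle 2 pi j / 3 for j =
  0, 1, 2.\<close>

definition coeff_matrix :: "nat \<Rightarrow> real^2^2" where
  "coeff_matrix j =
    (if j = 0 then vector [vector [3, 0], vector [0, 1]]
     else if j = 1 then vector [vector [3/2, - sqrt 3 / 2], vector [- sqrt 3 / 2, 5/2]]
     else vector [vector [3/2, sqrt 3 / 2], vector [sqrt 3 / 2, 5/2]])"

text \<open>The stretch by sqrt 3 across the axis turns the slope sqrt 3 of a half-angle pi/3 into
  the slope 3 of the wedge.\<close>

definition sector :: "nat \<Rightarrow> (real^2) set" where
  "sector j = lin j -` wedge"

text \<open>Ties on common rays are broken by index; \<open>sectors_agree\<close> makes this choice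
  immaterial.\<close>

definition sector_of :: "real^2 \<Rightarrow> nat" where
  "sector_of p = (if p \<in> sector 0 then 0 else if p \<in> sector 1 then 1 else 2)"

lemma sector_of_less: "sector_of p < 3"
  by (simp add: sector_of_def)

lemma less_3_cases: "j < 3 \<Longrightarrow> j = 0 \<or> j = 1 \<or> j = (2::nat)"
  by auto

lemma sqrt3_simps: "sqrt 3 * (sqrt 3 * x) = 3 * x" "x * sqrt 3 * sqrt 3 = 3 * x" "sqrt 3 * (x * sqrt 3) = 3 * x" for x
  by (simp_all flip: mult.assoc)

text \<open>Everything is linear in \<open>p$1\<close> and \<open>sqrt 3 * p$2\<close>, so covering
  and overlaps reduce to linear arithmetic.\<close>

lemma sector_iff:
  "p \<in> sector 0 \<longleftrightarrow> \<bar>sqrt 3 * p$2\<bar> \<le> 3 * p$1"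
  "p \<in> sector (Suc 0) \<longleftrightarrow> 0 \<le> sqrt 3 * p$2 \<and> 3 * p$1 \<le> sqrt 3 * p$2"
  "p \<in> sector 2 \<longleftrightarrow> sqrt 3 * p$2 \<le> 0 \<and> sqrt 3 * p$2 \<le> - 3 * p$1"
  unfolding sector_def wedge_def lin_def vimage_eq mem_Collect_eq form_def sum_2
  by (auto simp: abs_le_iff mult.commute)

lemma in_sector_of: "p \<in> sector (sector_of p)"
  by (auto simp: sector_of_def sector_iff)

lemma sector_cover: "sector 0 \<union> sector 1 \<union> sector 2 = UNIV"
  by (auto simp: sector_iff)

lemma bounded_linear_lin: "bounded_linear (lin j)"
  unfolding lin_def
  by (intro bounded_linear_sum bounded_linear_mult_const bounded_linear_compose[OF bounded_linear_of_real]
      bounded_linear_vec_nth)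

lemma lin_axis: "lin j (axis i 1) = form j i"
  using exhaust_2[of i] by (auto simp: lin_def sum_2 axis_def)

lemma closed_wedge: "closed wedge"
  unfolding wedge_def by (intro closed_Collect_le continuous_intros)

lemma closed_sector: "closed (sector j)"
  unfolding sector_def
  by (intro closed_vimage closed_wedge linear_continuous_on bounded_linear_lin)

abbreviation (input) \<sigma> :: real where "\<sigma> \<equiv> sigma_star"

section \<open>The solution on one sector and its derivatives\<close>

definition fn :: "nat \<Rightarrow> real^2 \<Rightarrow> real" where
  "fn j p = Re (lin j p powr of_real (2 + \<sigma>))"

definition grad_fn :: "nat \<Rightarrow> real^2 \<Rightarrow> real^2" where
  "grad_fn j p = (\<chi> i. Re (of_real (2 + \<sigma>) * lin j p powr of_real (1 + \<sigma>) * form j i))"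

text \<open>The Hessian of Re (F o \<open>lin j\<close>) for holomorphic F with second derivative
  \<open>z\<close>, since \<open>form j i\<close> is the i-th partial derivative of
  \<open>lin j\<close>.\<close>

definition hess_op :: "nat \<Rightarrow> complex \<Rightarrow> real^2^2" where
  "hess_op j z = (\<chi> i k. Re (z * form j i * form j k))"

definition hess_fn :: "nat \<Rightarrow> real^2 \<Rightarrow> real^2^2" where
  "hess_fn j p = hess_op j (of_real ((2 + \<sigma>) * (1 + \<sigma>)) * lin j p powr of_real \<sigma>)"

lemma fn_has_derivative:
  assumes "p \<in> sector j"
  shows "(fn j has_derivative (\<lambda>h. grad_fn j p \<bullet> h)) (at p within sector j)"
proof -
  have "((\<lambda>z. z powr of_real (2 + \<sigma>)) has_derivative
      (*) (of_real (2 + \<sigma>) * lin j p powr of_real (1 + \<sigma>))) (at (lin j p) within lin j ` sector j)"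
  proof (rule has_derivative_subset)
    show "((\<lambda>z. z powr of_real (2 + \<sigma>)) has_derivative
        (*) (of_real (2 + \<sigma>) * lin j p powr of_real (1 + \<sigma>))) (at (lin j p) within wedge)"
      using has_field_derivative_powr_wedge[of "lin j p" "2 + \<sigma>"] assms sigma_star_bounds
      by (simp add: has_field_derivative_def sector_def)
  qed (auto simp: sector_def)
  note D = has_derivative_Re[OF has_derivative_in_compose[OF bounded_linear_imp_has_derivative[OF bounded_linear_lin] this]]
  have "grad_fn j p \<bullet> h = Re (of_real (2 + \<sigma>) * lin j p powr of_real (1 + \<sigma>) * lin j h)" for h
    by (simp add: grad_fn_def inner_vec_def lin_def[of j h] sum_2 algebra_simps del: of_real_add)
  with D show ?thesis
    unfolding fn_def by simp
qed

lemma grad_fn_has_derivative: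
  assumes "p \<in> sector j"
  shows "(grad_fn j has_derivative (\<lambda>h. hess_fn j p *v h)) (at p within sector j)"
proof -
  have D: "((\<lambda>z. z powr of_real (1 + \<sigma>)) has_derivative
      (*) (of_real (1 + \<sigma>) * lin j p powr of_real \<sigma>)) (at (lin j p) within lin j ` sector j)"
  proof (rule has_derivative_subset)
    show "((\<lambda>z. z powr of_real (1 + \<sigma>)) has_derivative
        (*) (of_real (1 + \<sigma>) * lin j p powr of_real (\<sigma>))) (at (lin j p) within wedge)"
      using has_field_derivative_powr_wedge[of "lin j p" "1 + \<sigma>"] assms sigma_star_bounds
      by (simp add: has_field_derivative_def sector_def)
  qed (auto simp: sector_def)
  note D' = has_derivative_in_compose[OF bounded_linear_imp_has_derivative[OF bounded_linear_lin] D]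
  have comp: "((\<lambda>q. grad_fn j q $ i) has_derivative (\<lambda>h. (hess_fn j p *v h) $ i)) (at p within sector j)" for i
  proof -
    have "(hess_fn j p *v h) $ i = Re (of_real (2 + \<sigma>) *
        (of_real (1 + \<sigma>) * lin j p powr of_real \<sigma> * lin j h) * form j i)" for h
      by (simp add: hess_fn_def hess_op_def matrix_vector_mult_def lin_def[of j h] sum_2 algebra_simps)
    moreover note has_derivative_Re[OF has_derivative_mult_left[OF has_derivative_mult_right[OF D']],
        of "of_real (2 + \<sigma>)" "form j i"]
    ultimately show ?thesis
      unfolding grad_fn_def vec_lambda_beta by simp
  qed
  show ?thesis
    unfolding has_derivative_componentwise_within[of "grad_fn j"]
    using comp by (auto simp: Basis_vec_def inner_axis)
qed

section \<open>Signs of the traces and matching across common rays\<close>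

text \<open>The trace is Re (z q) for a constant q. Along and across the axis \<open>lin j\<close>
  has derivatives 1 and i sqrt 3, so k = j gives q = 3 * 1 + (i sqrt 3)^2 = 0; the neighbours give q
  = -6 - 3i and q = -6 + 3i. Both are harmless exactly when |Im z| <= 2 Re z.\<close>

lemma trace_coeff_hess:
  assumes "j < 3" "k < 3"
  shows "trace (coeff_matrix k ** hess_op j z) =
    (if k = j then 0 else if k = (if j = 2 then 0 else Suc j) then 3 * Im z - 6 * Re z
     else - 3 * Im z - 6 * Re z)"
  using less_3_cases[OF assms(1)] less_3_cases[OF assms(2)]
  by (elim disjE; simp add: trace_def matrix_matrix_mult_def sum_2 hess_op_def coeff_matrix_def form_def vector_2; simp add: field_simps sqrt3_simps)

text \<open>The common ray lies at angle pi/3 on opposite sides of the two axes, so its images are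
  mirror images on the two edges of the wedge.\<close>

lemma edge_lin:
  assumes "j < 3" "k = (if j = 2 then 0 else Suc j)" "p \<in> sector j" "p \<in> sector k"
  shows "lin k p = cnj (lin j p)" "Im (lin j p) = 3 * Re (lin j p)"
proof -
  have "lin k p = cnj (lin j p) \<and> Im (lin j p) = 3 * Re (lin j p)"
    using less_3_cases[OF assms(1)]
  proof (elim disjE)
    assume "j = 0"
    with assms show ?thesis by (auto simp: sector_iff lin_def form_def sum_2 complex_eq_iff mult.commute[of "sqrt 3"])
  next
    assume "j = 1"
    with assms show ?thesis by (auto simp: sector_iff numeral_2_eq_2[symmetric] lin_def form_def sum_2 complex_eq_iff mult.commute[of "sqrt 3"])
  next
    assume "j = 2"
    with assms show ?thesis by (auto simp: sector_iff lin_def form_def sum_2 complex_eq_iff mult.commute[of "sqrt 3"])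
  qed
  then show "lin k p = cnj (lin j p)" "Im (lin j p) = 3 * Re (lin j p)" by auto
qed

text \<open>Conjugation preserves the derivative along the ray and flips the normal one. The normal
  has image a multiple of -1 + i under \<open>lin j\<close>, and (-1 + i)^2 = -2i has real part 0,
  so the normal derivative vanishes.\<close>

lemma edge_form_grad:
  assumes "j < 3" "k = (if j = 2 then 0 else Suc j)"
  shows "Re (Complex (- y) y * form j i) = Re (Complex (- y) (- y) * form k i)"
  using less_3_cases[OF assms(1)] assms(2) exhaust_2[of i]
  by (elim disjE; simp add: form_def)

text \<open>Only the mixed tangential-normal entry changes sign under conjugation, and it vanishes:
  (1 + 2i)(1 + 3i)(-1 + i) = -10i.\<close>

lemma edge_form_hess:
  assumes "j < 3" "k = (if j = 2 then 0 else Suc j)"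
  shows "Re (Complex y (2 * y) * form j i * form j l) = Re (Complex y (- 2 * y) * form k i * form k l)"
  using less_3_cases[OF assms(1)] assms(2) exhaust_2[of i] exhaust_2[of l]
  by (elim disjE; simp add: form_def)
lemma edge_agree:
  assumes "j < 3" "k = (if j = 2 then 0 else Suc j)" "p \<in> sector j" "p \<in> sector k"
  shows "fn j p = fn k p" "grad_fn j p = grad_fn k p" "hess_fn j p = hess_fn k p"
proof -
  define z where "z = lin j p"
  note z = edge_lin[OF assms, folded z_def]
  have wedge: "z \<in> wedge"
    using assms(3) by (simp add: z_def sector_def)
  \<comment> \<open>Conjugation commutes with the principal power off the negative real axis, which
    the wedge avoids.\<close>
  have cnj_powr_z: "cnj z powr of_real a = cnj (z powr of_real a)" for a
    using wedge by (subst cnj_powr) (auto simp: wedge_def)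
  define P where "P = z powr of_real \<sigma>"
  have P: "P = Complex (Re P) (2 * Re P)"
    using wedge_edge_powr_sigma_star[OF z(2) wedge] by (simp add: P_def complex_eq_iff)
  \<comment> \<open>From z = Re z (1 + 3i), P = Re P (1 + 2i) and (1 + 3i)(1 + 2i) = 5(-1 +
    i).\<close>
  define y where "y = 5 * Re P * Re z"
  have "z powr of_real (1 + \<sigma>) = z * P"
    using powr_Suc_complex[of z "of_real \<sigma>"] by (simp add: P_def)
  also have "\<dots> = Complex (- y) y"
    by (subst P) (simp add: complex_eq_iff z(2) y_def)
  finally have zP: "z powr of_real (1 + \<sigma>) = Complex (- y) y" .
  show "fn j p = fn k p"
    unfolding fn_def z z_def[symmetric] cnj_powr_z by simp
  show "grad_fn j p = grad_fn k p"
    unfolding grad_fn_def z z_def[symmetric] cnj_powr_z zP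
    using edge_form_grad[OF assms(1,2), of "(2 + \<sigma>) * y"]
    by (simp add: vec_eq_iff algebra_simps)
  have "hess_op j (Complex c (2 * c)) = hess_op k (Complex c (- 2 * c))" for c
    using edge_form_hess[OF assms(1,2)] by (simp add: hess_op_def)
  moreover have "of_real c * P = Complex (c * Re P) (2 * (c * Re P))"
    "cnj (of_real c * P) = Complex (c * Re P) (- 2 * (c * Re P))" for c
    by (subst P; simp add: complex_eq_iff)+
  ultimately have "hess_op j (of_real c * P) = hess_op k (cnj (of_real c * P))" for c
    by metis
  then have "hess_op j (of_real ((2 + \<sigma>) * (1 + \<sigma>)) * P) = hess_op k (of_real ((2 + \<sigma>) * (1 + \<sigma>)) * cnj P)"
    by (metis complex_cnj_complex_of_real complex_cnj_mult)
  then show "hess_fn j p = hess_fn k p"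
    unfolding hess_fn_def z z_def[symmetric] cnj_powr_z P_def[symmetric] .
qed

lemma sectors_agree:
  assumes "j < 3" "k < 3" "p \<in> sector j" "p \<in> sector k"
  shows "fn j p = fn k p" "grad_fn j p = grad_fn k p" "hess_fn j p = hess_fn k p"
proof -
  \<comment> \<open>Among three sectors any two distinct ones are cyclic neighbours, in one order or
    the other.\<close>
  have "j = k \<or> k = (if j = 2 then 0 else Suc j) \<or> j = (if k = 2 then 0 else Suc k)"
    using assms(1,2) by auto
  then have "fn j p = fn k p \<and> grad_fn j p = grad_fn k p \<and> hess_fn j p = hess_fn k p"
    using edge_agree[OF assms(1) _ assms(3,4)] edge_agree[OF assms(2) _ assms(4,3)] by metis
  then show "fn j p = fn k p" "grad_fn j p = grad_fn k p" "hess_fn j p = hess_fn k p"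
    by auto
qed

section \<open>The glued solution and its regularity\<close>

definition sol :: "real^2 \<Rightarrow> real" where
  "sol p = fn (sector_of p) p"

definition grad_sol :: "real^2 \<Rightarrow> real^2" where
  "grad_sol p = grad_fn (sector_of p) p"

definition hess_sol :: "real^2 \<Rightarrow> real^2^2" where
  "hess_sol p = hess_fn (sector_of p) p"

lemma sol_eq:
  assumes "j < 3" "p \<in> sector j"
  shows "sol p = fn j p" "grad_sol p = grad_fn j p" "hess_sol p = hess_fn j p"
  unfolding sol_def grad_sol_def hess_sol_def
  using sectors_agree[OF sector_of_less assms(1) in_sector_of assms(2)] by auto

lemma interior_sectors: "p \<in> interior (\<Union>j\<in>{..<3}. sector j)"
  using sector_of_less in_sector_of by (metis UNIV_I UNIV_eq_I UN_I interior_UNIV lessThan_iff)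

lemma sol_has_derivative: "(sol has_derivative (\<lambda>h. grad_sol p \<bullet> h)) (at p)"
proof (rule has_derivative_glue[of "{..<3}" p sector fn])
  show "(fn j has_derivative (\<lambda>h. grad_sol p \<bullet> h)) (at p within sector j)" if "j \<in> {..<3}" "p \<in> sector j" for j
    using fn_has_derivative[OF that(2)] sol_eq[of j p] that by simp
qed (auto simp: closed_sector sol_eq interior_sectors)

lemma grad_sol_has_derivative: "(grad_sol has_derivative (\<lambda>h. hess_sol p *v h)) (at p)"
proof (rule has_derivative_glue[of "{..<3}" p sector grad_fn])
  show "(grad_fn j has_derivative (\<lambda>h. hess_sol p *v h)) (at p within sector j)" if "j \<in> {..<3}" "p \<in> sector j" for j
    using grad_fn_has_derivative[OF that(2)] sol_eq[of j p] that by simp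
qed (auto simp: closed_sector sol_eq interior_sectors)

lemma gradient_sol: "gradient sol = grad_sol"
proof
  fix p
  have "frechet_derivative sol (at p) = (\<lambda>h. grad_sol p \<bullet> h)"
    using frechet_derivative_at[OF sol_has_derivative] by simp
  then show "gradient sol p = grad_sol p"
    by (simp add: gradient_def vec_eq_iff inner_axis)
qed

lemma hessian_sol: "hessian sol = hess_sol"
proof
  fix p
  have "frechet_derivative grad_sol (at p) = (\<lambda>h. hess_sol p *v h)"
    using frechet_derivative_at[OF grad_sol_has_derivative] by simp
  then show "hessian sol p = hess_sol p"
    by (simp add: hessian_def jacobian_def gradient_sol matrix_of_matrix_vector_mul)
qed

lemma bounded_linear_hess_op: "bounded_linear (hess_op j)"
  unfolding linear_conv_bounded_linear[symmetric]
  by (rule linearI) (simp_all add: hess_op_def vec_eq_iff distrib_right left_diff_distrib right_diff_distrib)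

text \<open>On each sector the Hessian is a linear image of the \<sigma>-th power of a linear map,
  so the wedge estimate transfers; the sum of the three constants serves as a common one for
  gluing.\<close>

lemma holder_hess_sol: "\<exists>D. holder_on \<sigma> D UNIV hess_sol"
proof -
  have bl: "bounded_linear (\<lambda>z. hess_op j (of_real ((2 + \<sigma>) * (1 + \<sigma>)) * z))" for j
    by (intro bounded_linear_compose[OF bounded_linear_hess_op] bounded_linear_mult_right)
  have "\<exists>D\<ge>0. holder_on \<sigma> D (sector j) hess_sol" if "j < 3" for j
  proof -
    have "\<exists>D\<ge>0. holder_on \<sigma> D (sector j) (hess_fn j)"
      unfolding hess_fn_def
      using holder_on_bounded_linear_compose[OF holder_powr_wedge[OF sigma_star_bounds] _ _ bl bounded_linear_lin, where S="sector j"]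
        sigma_star_bounds by (auto simp: sector_def)
    then show ?thesis
      using sol_eq(3)[OF that] by (simp add: holder_on_def)
  qed
  from this[of 0] this[of 1] this[of 2]
  obtain D0 D1 D2 where D: "0 \<le> D0" "holder_on \<sigma> D0 (sector 0) hess_sol"
    "0 \<le> D1" "holder_on \<sigma> D1 (sector 1) hess_sol" "0 \<le> D2" "holder_on \<sigma> D2 (sector 2) hess_sol"
    by auto
  have "holder_on \<sigma> (3 * (D0 + D1 + D2)) UNIV hess_sol"
    using D sigma_star_bounds
    by (intro holder_glue[OF closed_sector closed_sector closed_sector sector_cover])
      (auto intro: holder_on_mono)
  then show ?thesis ..
qed

lemma sol_C2_holder_loc: "sol \<in> C2_holder_loc \<sigma>"
proof -
  obtain D where D: "holder_on \<sigma> D UNIV hess_sol"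
    using holder_hess_sol by blast
  have "sol differentiable_on UNIV" "grad_sol differentiable_on UNIV"
    using sol_has_derivative grad_sol_has_derivative
    by (auto simp: differentiable_on_def differentiable_def)
  moreover have "continuous_on UNIV hess_sol"
    using holder_on_imp_continuous_on[OF D] sigma_star_bounds by simp
  ultimately show ?thesis
    using D by (auto simp: C2_holder_loc_def C2_def gradient_sol hessian_sol locally_holder_def holder_on_def)
qed

section \<open>Homogeneity, the equation and sharpness of the exponent\<close>

lemma lin_scaleR: "lin j (t *\<^sub>R p) = of_real t * lin j p"
  by (simp add: lin_def sum_distrib_left mult_ac)

lemma sector_scaleR: "0 < t \<Longrightarrow> t *\<^sub>R p \<in> sector j \<longleftrightarrow> p \<in> sector j"
  by (auto simp: sector_def wedge_def lin_scaleR abs_mult mult.left_commute)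

lemma homogeneous_sol: "homogeneous_of_degree (2 + \<sigma>) sol"
  unfolding homogeneous_of_degree_def
proof (intro allI impI)
  fix t :: real and p :: "real^2" assume t: "0 < t"
  then have "sector_of (t *\<^sub>R p) = sector_of p"
    by (simp add: sector_of_def sector_scaleR)
  then show "sol (t *\<^sub>R p) = t powr (2 + \<sigma>) * sol p"
    using powr_of_real_scale[OF t, of "lin (sector_of p) p" "2 + \<sigma>"]
    by (simp add: sol_def fn_def lin_scaleR)
qed

text \<open>The operator belonging to the sector of \<open>p\<close> attains 0; the other two are
  nonpositive by the bound on the argument of the power.\<close>

lemma Max_trace_sol: "(MAX j\<in>{0,1,2}. trace (coeff_matrix j ** hess_sol p)) = 0"
proof -
  define j where "j = sector_of p"
  define c where "c = (2 + \<sigma>) * (1 + \<sigma>)"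
  define P where "P = lin j p powr of_real \<sigma>"
  have "0 < c"
    using sigma_star_bounds by (simp add: c_def)
  have "\<bar>Im P\<bar> \<le> 2 * Re P"
    using wedge_powr_sigma_star[of "lin j p"] in_sector_of[of p] by (simp add: P_def j_def sector_def)
  then have "\<bar>c * Im P\<bar> \<le> c * (2 * Re P)"
    using \<open>0 < c\<close> by (simp add: abs_mult)
  then have *: "\<bar>Im (of_real c * P)\<bar> \<le> 2 * Re (of_real c * P)"
    by simp
  have "hess_sol p = hess_op j (of_real c * P)"
    by (simp add: hess_sol_def hess_fn_def j_def c_def P_def)
  then have tr: "trace (coeff_matrix k ** hess_sol p) = 0" if "k = j" "k < 3" for k
    using that trace_coeff_hess[of j k] by simp
  have le: "trace (coeff_matrix k ** hess_sol p) \<le> 0" if "k < 3" for k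
    using * trace_coeff_hess[of j k "of_real c * P"] that sector_of_less[of p]
      \<open>hess_sol p = hess_op j (of_real c * P)\<close>
    by (auto simp: j_def)
  show ?thesis
  proof (rule Max_eqI)
    show "0 \<in> (\<lambda>j. trace (coeff_matrix j ** hess_sol p)) ` {0, 1, 2}"
      using tr[OF refl] sector_of_less[of p] less_3_cases[of j] by (auto simp: j_def)
  qed (auto simp: le)
qed

lemma norm_axis: "norm (axis i t :: real^'n) = \<bar>t\<bar>"
  by (simp add: norm_eq_sqrt_inner inner_axis_axis)

text \<open>On this half-axis \<open>lin 0\<close> is real, so the entry is the second derivative of
  t^(2 + \<sigma>). The case t = 0 gives the value at the origin.\<close>

lemma hess_sol_axis:
  assumes "0 \<le> t"
  shows "hess_sol (axis 1 t) $ 1 $ 1 = (2 + \<sigma>) * (1 + \<sigma>) * t powr \<sigma>"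
proof -
  have "lin 0 (axis 1 t) = of_real t"
    by (simp add: lin_def form_def sum_2 axis_def)
  moreover from this have "axis 1 t \<in> sector 0"
    using assms by (simp add: sector_def wedge_def)
  ultimately show ?thesis
    using assms sol_eq(3)[of 0 "axis 1 t"]
    by (simp add: hess_fn_def hess_op_def form_def powr_of_real)
qed

text \<open>Along the first half-axis the Hessian grows at least like t^\<sigma>; a bound C
  t^\<beta> would force 1 <= C t^(\<beta> - \<sigma>), whose right side tends to 0.\<close>

lemma not_C2_holder_at_origin_sol:
  assumes "\<sigma> < \<beta>"
  shows "\<not> C2_holder_at_origin \<beta> sol"
proof
  assume "C2_holder_at_origin \<beta> sol"
  then obtain C r where C: "0 < C" "0 < r"
    "\<And>x. norm x < r \<Longrightarrow> norm (hess_sol x - hess_sol 0) \<le> C * norm x powr \<beta>"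
    by (auto simp: C2_holder_at_origin_def hessian_sol)
  have entry: "B $ 1 $ 1 \<le> norm B" for B :: "real^2^2"
    using component_le_norm_cart[of "B $ 1" 1] Finite_Cartesian_Product.norm_nth_le[of B 1] by simp
  have zero: "hess_sol 0 $ 1 $ 1 = 0"
    using hess_sol_axis[of 0] by (simp add: axis_def flip: zero_vec_def)
  have bound: "1 \<le> C * t powr (\<beta> - \<sigma>)" if "0 < t" "t < r" for t
  proof -
    have "1 * t powr \<sigma> \<le> (2 + \<sigma>) * (1 + \<sigma>) * t powr \<sigma>"
      using sigma_star_bounds by (intro mult_right_mono) (auto simp: algebra_simps)
    also have "\<dots> \<le> norm (hess_sol (axis 1 t) - hess_sol 0)"
      using hess_sol_axis[of t] that zero entry[of "hess_sol (axis 1 t) - hess_sol 0"] by simp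
    also have "\<dots> \<le> C * t powr \<beta>"
      using C(3)[of "axis 1 t"] that by (simp add: norm_axis)
    finally have "t powr \<sigma> \<le> C * t powr \<beta>" by simp
    then show ?thesis
      using that by (simp add: powr_diff field_simps)
  qed
  have "((\<lambda>t. C * t powr (\<beta> - \<sigma>)) \<longlongrightarrow> C * 0 powr (\<beta> - \<sigma>)) (at_right 0)"
    using assms by (intro tendsto_intros tendsto_powr2)
      (auto simp: eventually_at_filter intro!: tendsto_eq_intros)
  then have "((\<lambda>t. C * t powr (\<beta> - \<sigma>)) \<longlongrightarrow> 0) (at_right 0)"
    by simp
  moreover have "\<forall>\<^sub>F t in at_right 0. 1 \<le> C * t powr (\<beta> - \<sigma>)"
    using eventually_at_right_real[OF \<open>0 < r\<close>] by eventually_elim (auto intro: bound)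
  ultimately have "(1::real) \<le> 0"
    by (rule tendsto_lowerbound) simp
  then show False by simp
qed

section \<open>Ellipticity of the coefficient matrices\<close>

lemma coeff_matrix_bounds:
  "coeff_matrix j \<in> sym_matrices"
  "quad_form_le (mat 1) (coeff_matrix j)" "quad_form_le (coeff_matrix j) (3 *\<^sub>R mat 1)"
proof -
  show "coeff_matrix j \<in> sym_matrices"
    by (simp add: sym_matrices_def coeff_matrix_def transpose_def vec_eq_iff forall_2)
  \<comment> \<open>Both gaps, to Id and to 3 Id, are rank-one forms. For the two oblique axes they
    are half of these squares.\<close>
  have sq: "0 \<le> (v$1 - sqrt 3 * v$2)\<^sup>2" "0 \<le> (v$1 + sqrt 3 * v$2)\<^sup>2"
    "0 \<le> (sqrt 3 * v$1 - v$2)\<^sup>2" "0 \<le> (sqrt 3 * v$1 + v$2)\<^sup>2" for v :: "real^2"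
    by simp_all
  show "quad_form_le (mat 1) (coeff_matrix j)"
    unfolding quad_form_le_def
  proof
    fix v :: "real^2"
    show "v \<bullet> (mat 1 *v v) \<le> v \<bullet> (coeff_matrix j *v v)"
      using sq[of v]
      by (simp add: inner_vec_def matrix_vector_mult_def coeff_matrix_def sum_2 mat_def vector_2
          power2_eq_square algebra_simps sqrt3_simps)
  qed
  show "quad_form_le (coeff_matrix j) (3 *\<^sub>R mat 1)"
    unfolding quad_form_le_def
  proof
    fix v :: "real^2"
    show "v \<bullet> (coeff_matrix j *v v) \<le> v \<bullet> ((3 *\<^sub>R mat 1) *v v)"
      using sq[of v]
      by (simp add: inner_vec_def matrix_vector_mult_def coeff_matrix_def sum_2 mat_def vector_2
          power2_eq_square algebra_simps sqrt3_simps)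
  qed
qed

theorem theorem1p2:
  shows "0 < sigma_star \<and> sigma_star < 1 \<and>
    (\<exists>(A :: nat \<Rightarrow> real^2^2) (u :: real^2 \<Rightarrow> real).
       (\<forall>j\<in>{0,1,2}. A j \<in> sym_matrices
          \<and> quad_form_le (mat 1) (A j) \<and> quad_form_le (A j) (3 *\<^sub>R mat 1)) \<and>
       u \<noteq> (\<lambda>x. 0) \<and>
       u \<in> C2_holder_loc sigma_star \<and>
       homogeneous_of_degree (2 + sigma_star) u \<and>
       (\<forall>x. (MAX j\<in>{0,1,2}. trace (A j ** hessian u x)) = 0) \<and>
       (\<forall>\<beta>>sigma_star. \<not> C2_holder_at_origin \<beta> u))"
proof -
  have "sol (axis 1 1) = 1"
  proof -
    have "lin 0 (axis 1 1) = 1"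
      by (simp add: lin_axis form_def)
    then show ?thesis
      using sol_eq(1)[of 0 "axis 1 1"] by (simp add: sector_def wedge_def fn_def)
  qed
  then have "sol \<noteq> (\<lambda>x. 0)" by (metis zero_neq_one)
  then show ?thesis
    using sigma_star_bounds coeff_matrix_bounds sol_C2_holder_loc homogeneous_sol
      Max_trace_sol not_C2_holder_at_origin_sol
    unfolding hessian_sol[symmetric] by (intro conjI exI[of _ coeff_matrix] exI[of _ sol]) auto
qed

end
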